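(* Let $n, m$ be nonnegative integers, and let $T(k)$ denote the number of labeled topologies on $k$ points. Then: (i) $T(n+m) \geq T(n)\, T(m)$. (ii) If $n+m\ge 2$, then $T(n+m) \geq \max\{ T(i)\, T(m+n-i) : 1 \leq i \leq n+m-1 \}$.
   Context: For a nonnegative integer $k$ and a finite set $E$ with $|E|=k$, a topology on $E$ (a topology on $k$ points) is a collection $\tau$ of subsets of $E$ containing $\emptyset$ and $E$ and closed under (pairwise) union and intersection. The number $T(k)$ of labeled topologies on $k$ points is the number of distinct topologies on a fixed set of cardinality $k$. *)

theory Defs
  imports "HOL-Analysis.Analysis"
begin

text \<open>
  The number T(k) of labeled topologies on k points, counted with the library type of
  topologies (whose points form the set topspace) on the reference set of the k numbers below k.
  The lemmas below show that this count is that of the collections of subsets closed under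
  pairwise union and intersection, on any finite set with k elements.
\<close>

definition num_topologies :: "nat \<Rightarrow> nat" where
  "num_topologies k = card {X :: nat topology. topspace X = {..<k}}"

definition finite_topology_on :: "'a set \<Rightarrow> 'a set set \<Rightarrow> bool" where
  "finite_topology_on E \<tau> \<longleftrightarrow> \<tau> \<subseteq> Pow E \<and> {} \<in> \<tau> \<and> E \<in> \<tau>
     \<and> (\<forall>U\<in>\<tau>. \<forall>V\<in>\<tau>. U \<union> V \<in> \<tau> \<and> U \<inter> V \<in> \<tau>)"

lemma finite_topology_on_Union:
  assumes "finite E" "finite_topology_on E \<tau>" "\<K> \<subseteq> \<tau>"
  shows "\<Union>\<K> \<in> \<tau>"
proof -
  have "finite \<K>"
    using assms by (meson finite_Pow_iff finite_subset finite_topology_on_def)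
  then show ?thesis
    using assms(3)
    by (induction rule: finite_induct) (use assms(2) in \<open>auto simp: finite_topology_on_def\<close>)
qed

lemma bij_betw_topologies:
  fixes E :: "'a set"
  assumes "finite E"
  shows "bij_betw (\<lambda>X. {U. openin X U}) {X. topspace X = E} {\<tau>. finite_topology_on E \<tau>}"
proof (rule bij_betw_byWitness[where f' = "\<lambda>\<tau>. topology (\<lambda>U. U \<in> \<tau>)"])
  have op: "openin (topology (\<lambda>U. U \<in> \<tau>)) = (\<lambda>U. U \<in> \<tau>)" if "finite_topology_on E \<tau>" for \<tau>
  proof (rule topology_inverse')
    show "istopology (\<lambda>U. U \<in> \<tau>)"
      unfolding istopology_def
      using that finite_topology_on_Union[OF assms that]
      by (auto simp: finite_topology_on_def subset_iff)
  qed
  show "\<forall>X\<in>{X. topspace X = E}. topology (\<lambda>U. U \<in> {U. openin X U}) = X"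
    by (simp add: openin_inverse)
  show "\<forall>\<tau>\<in>{\<tau>. finite_topology_on E \<tau>}. {U. openin (topology (\<lambda>U. U \<in> \<tau>)) U} = \<tau>"
    by (simp add: op)
  show "(\<lambda>X. {U. openin X U}) ` {X. topspace X = E} \<subseteq> {\<tau>. finite_topology_on E \<tau>}"
    by (auto simp: finite_topology_on_def dest: openin_subset)
  show "(\<lambda>\<tau>. topology (\<lambda>U. U \<in> \<tau>)) ` {\<tau>. finite_topology_on E \<tau>} \<subseteq> {X. topspace X = E}"
    by (auto simp: topspace_def op) (auto simp: finite_topology_on_def)
qed

lemma finite_finite_topology_on: "finite E \<Longrightarrow> finite {\<tau>. finite_topology_on E \<tau>}"
  by (rule finite_subset[of _ "Pow (Pow E)"]) (auto simp: finite_topology_on_def)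

lemma finite_topologies: "finite E \<Longrightarrow> finite {X. topspace X = E}"
  using bij_betw_topologies bij_betw_finite finite_finite_topology_on by blast

lemma finite_topology_on_image:
  assumes "inj_on f E" "finite_topology_on E \<tau>"
  shows "finite_topology_on (f ` E) ((`) f ` \<tau>)"
proof -
  have "f ` U \<inter> f ` V = f ` (U \<inter> V)" if "U \<in> \<tau>" "V \<in> \<tau>" for U V
    using assms that inj_on_image_Int[of f E U V] by (auto simp: finite_topology_on_def)
  then show ?thesis
    using assms(2) by (fastforce simp: finite_topology_on_def image_Un[symmetric])
qed

lemma card_finite_topology_on_le:
  assumes "finite F" "bij_betw f E F"
  shows "card {\<tau>. finite_topology_on E \<tau>} \<le> card {\<tau>. finite_topology_on F \<tau>}"
proof (rule card_inj_on_le[where f = "\<lambda>\<tau>. (`) f ` \<tau>"])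
  have inj: "inj_on f E" and im: "f ` E = F"
    using assms(2) by (auto simp: bij_betw_def)
  have "inj_on ((`) ((`) f)) (Pow (Pow E))"
    by (intro inj_on_image_Pow inj)
  then show "inj_on (\<lambda>\<tau>. (`) f ` \<tau>) {\<tau>. finite_topology_on E \<tau>}"
    by (rule inj_on_subset) (auto simp: finite_topology_on_def)
  show "(\<lambda>\<tau>. (`) f ` \<tau>) ` {\<tau>. finite_topology_on E \<tau>} \<subseteq> {\<tau>. finite_topology_on F \<tau>}"
    using finite_topology_on_image[OF inj] im by auto
  show "finite {\<tau>. finite_topology_on F \<tau>}"
    by (rule finite_finite_topology_on[OF assms(1)])
qed

lemma num_topologies_eq_card_finite_topology_on:
  fixes E :: "'a set"
  assumes "finite E" "card E = k"
  shows "num_topologies k = card {\<tau>. finite_topology_on E \<tau>}"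
proof -
  obtain f where f: "bij_betw f E {..<k}"
    using assms by (metis card_lessThan finite_lessThan finite_same_card_bij)
  have "card {\<tau>. finite_topology_on E \<tau>} = card {\<tau>. finite_topology_on {..<k} \<tau>}"
    using card_finite_topology_on_le[OF _ f] card_finite_topology_on_le[OF assms(1) bij_betw_inv_into[OF f]]
    by simp
  then show ?thesis
    unfolding num_topologies_def
    using bij_betw_same_card[OF bij_betw_topologies[of "{..<k}"]] by simp
qed

lemma num_topologies_eq_card:
  fixes E :: "'a set"
  assumes "finite E" "card E = k"
  shows "num_topologies k = card {X. topspace X = E}"
  using num_topologies_eq_card_finite_topology_on[OF assms]
    bij_betw_same_card[OF bij_betw_topologies[OF assms(1)]] by simp

end

theory Submission
  imports Defs
begin

text \<open>
  Split a set of \<open>n + m\<close> points into disjoint blocks \<open>A\<close> and \<open>B\<close> of \<open>n\<close> and \<open>m\<close> points. A topology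
  on \<open>A\<close> and one on \<open>B\<close> determine their disjoint sum on \<open>A \<union> B\<close>, and both can be read off again:
  the open sets of the sum that lie inside a block are exactly the open sets of the topology chosen
  on that block. So the disjoint sum embeds pairs of topologies into the topologies on \<open>n + m\<close>
  points, and the product inequality follows. The bound on the maximum consists of instances of
  that inequality, one for each way of splitting \<open>n + m\<close> into two positive parts.
\<close>

definition disjoint_sum_opens :: "'a set \<Rightarrow> 'a set \<Rightarrow> 'a set set \<Rightarrow> 'a set set \<Rightarrow> 'a set set" where
  "disjoint_sum_opens A B \<sigma> \<tau> = {W \<in> Pow (A \<union> B). W \<inter> A \<in> \<sigma> \<and> W \<inter> B \<in> \<tau>}"

lemma finite_topology_on_disjoint_sum_opens:
  assumes "finite_topology_on A \<sigma>" "finite_topology_on B \<tau>"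
  shows "finite_topology_on (A \<union> B) (disjoint_sum_opens A B \<sigma> \<tau>)"
proof -
  have E: "(A \<union> B) \<inter> A = A" "(A \<union> B) \<inter> B = B"
    by auto
  have U: "(U \<union> V) \<inter> C = (U \<inter> C) \<union> (V \<inter> C)" for U V C :: "'a set"
    by auto
  have I: "U \<inter> V \<inter> C = (U \<inter> C) \<inter> (V \<inter> C)" for U V C :: "'a set"
    by auto
  have "U \<union> V \<in> disjoint_sum_opens A B \<sigma> \<tau> \<and> U \<inter> V \<in> disjoint_sum_opens A B \<sigma> \<tau>"
    if "U \<in> disjoint_sum_opens A B \<sigma> \<tau>" "V \<in> disjoint_sum_opens A B \<sigma> \<tau>" for U V
    using that assms
    by (simp add: disjoint_sum_opens_def finite_topology_on_def U I[of U V A] I[of U V B]) blast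
  then show ?thesis
    using assms by (simp add: finite_topology_on_def E) (auto simp: disjoint_sum_opens_def E)
qed

text \<open>
  An open set of the sum contained in one block meets the other block in the empty set, which is
  open there; hence being open in the sum amounts to being open in its own block.
\<close>

lemma disjoint_sum_opens_Int_Pow:
  assumes "A \<inter> B = {}" "finite_topology_on A \<sigma>" "finite_topology_on B \<tau>"
  shows "disjoint_sum_opens A B \<sigma> \<tau> \<inter> Pow A = \<sigma>" "disjoint_sum_opens A B \<sigma> \<tau> \<inter> Pow B = \<tau>"
proof -
  have A: "W \<inter> A = W" "W \<inter> B = {}" if "W \<subseteq> A" for W
    using that assms(1) by auto
  have B: "W \<inter> B = W" "W \<inter> A = {}" if "W \<subseteq> B" for W
    using that assms(1) by auto
  show "disjoint_sum_opens A B \<sigma> \<tau> \<inter> Pow A = \<sigma>" "disjoint_sum_opens A B \<sigma> \<tau> \<inter> Pow B = \<tau>"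
    using assms(2,3) by (auto simp: finite_topology_on_def disjoint_sum_opens_def A B)
qed

lemma card_finite_topology_on_disjoint_Un:
  assumes "finite A" "finite B" "A \<inter> B = {}"
  shows "card {\<sigma>. finite_topology_on A \<sigma>} * card {\<tau>. finite_topology_on B \<tau>}
    \<le> card {\<rho>. finite_topology_on (A \<union> B) \<rho>}"
proof -
  let ?P = "{\<sigma>. finite_topology_on A \<sigma>} \<times> {\<tau>. finite_topology_on B \<tau>}"
  have "inj_on (\<lambda>(\<sigma>, \<tau>). disjoint_sum_opens A B \<sigma> \<tau>) ?P"
    by (rule inj_on_inverseI[where g = "\<lambda>\<rho>. (\<rho> \<inter> Pow A, \<rho> \<inter> Pow B)"])
      (auto simp only: mem_Times_iff mem_Collect_eq split_beta fst_conv snd_conv prod.collapse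
        disjoint_sum_opens_Int_Pow[OF assms(3)])
  then have "card ?P \<le> card {\<rho>. finite_topology_on (A \<union> B) \<rho>}"
    by (rule card_inj_on_le)
      (use assms in \<open>auto intro: finite_topology_on_disjoint_sum_opens finite_finite_topology_on\<close>)
  then show ?thesis
    by (simp add: card_cartesian_product)
qed

lemma num_topologies_add_ge_mult:
  "num_topologies n * num_topologies m \<le> num_topologies (n + m)"
proof -
  let ?A = "{..<n}" and ?B = "{n..<n + m}"
  have "?A \<inter> ?B = {}" "?A \<union> ?B = {..<n + m}"
    by auto
  then show ?thesis
    using card_finite_topology_on_disjoint_Un[of ?A ?B]
    by (simp add: num_topologies_eq_card_finite_topology_on[of ?A n]
        num_topologies_eq_card_finite_topology_on[of ?B m]
        num_topologies_eq_card_finite_topology_on[of "{..<n + m}" "n + m"])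
qed

theorem corollary3p4:
  fixes n m :: nat
  shows "num_topologies (n + m) \<ge> num_topologies n * num_topologies m \<and>
    (n + m \<ge> 2 \<longrightarrow>
      num_topologies (n + m) \<ge>
        Max {num_topologies i * num_topologies (m + n - i) | i. 1 \<le> i \<and> i \<le> n + m - 1})"
proof (intro conjI impI)
  show "num_topologies n * num_topologies m \<le> num_topologies (n + m)"
    by (rule num_topologies_add_ge_mult)
next
  assume "n + m \<ge> 2"
  let ?f = "\<lambda>i. num_topologies i * num_topologies (m + n - i)"
  have eq: "{?f i | i. 1 \<le> i \<and> i \<le> n + m - 1} = ?f ` {1..n + m - 1}"
    by auto
  have "?f i \<le> num_topologies (n + m)" if "i \<in> {1..n + m - 1}" for i
  proof -
    have "i + (m + n - i) = n + m"
      using that by auto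
    then show ?thesis
      using num_topologies_add_ge_mult[of i "m + n - i"] by simp
  qed
  \<comment> \<open>At least two points are needed for the maximum to range over a nonempty set.\<close>
  moreover have "{1..n + m - 1} \<noteq> {}"
    using \<open>n + m \<ge> 2\<close> by simp
  ultimately show "Max {?f i | i. 1 \<le> i \<and> i \<le> n + m - 1} \<le> num_topologies (n + m)"
    unfolding eq by (intro Max.boundedI) auto
qed

end
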